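(* Let $\psi^{\ell} \in V_h^{\theta}$, $\ell \in \{1,\dots,L\}$, be a discrete eigenfunction with eigenvalue $\lambda_{\ell}$, i.e. $$\int_0^{\pi} \frac{\partial \psi^{\ell}}{\partial \theta}\,\frac{\partial \vartheta_h}{\partial \theta}\,\sin^3(\theta)\, d\theta = \lambda_{\ell} \int_0^{\pi} \psi^{\ell}\,\vartheta_h\,\sin^3(\theta)\, d\theta \quad \text{for all } \vartheta_h \in V_h^{\theta}.$$ Let $u_h^{\ell} \in V_h^{R_j}$ with $u_h^{\ell}(R_j) = 1$ be the solution to $$\int_{R_j}^{R_{\oplus}} \left( -\rho r^2 \omega^2 u_h^{\ell} R_h + r^2 \mu \frac{\partial u_h^{\ell}}{\partial r}\frac{\partial R_h}{\partial r} + \lambda_{\ell}\, \mu\, u_h^{\ell} R_h \right) r^2 \, dr = 0$$ for all $R_h \in \{ v_h \in V_h^{R_j} \mid v_h(R_j) = 0 \}$. Then $$\mathrm{DtN}_j(\psi^{\ell}) = -(R_j)^4\, \mu(R_j)\, \partial_r u_h^{\ell}(R_j)\, \psi^{\ell}.$$ Here $V_h^{\theta}$, $V_h^{R_j}$, $\rho$, $\mu$, $\omega$ and the discrete Dirichlet-to-Neumann map $\mathrm{DtN}_j$ are as defined in the context.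
   Context: Setting: $0 < R_j < R_{\oplus}$ are fixed radii and $\omega$ is a fixed frequency. The coefficients are spherically symmetric: the mass density $\rho = \rho(r)$ and the shear modulus $\mu = \mu(r)$ are bounded, piecewise smooth functions of $r$ only, on $[R_j, R_{\oplus}]$. Finite element spaces: $V_h^{R_j} \subset H^1((R_j,R_{\oplus}))$ and $V_h^{\theta} \subset H_0^1((0,\pi))$ are finite-dimensional one-dimensional finite element spaces (continuous piecewise polynomials), and $W_h^{R_j} = V_h^{R_j} \otimes V_h^{\theta} \subset H^1((R_j,R_{\oplus})\times(0,\pi))$ is their tensor product, i.e. the space of linear combinations of functions $R_h(r)\vartheta_h(\theta)$ with $R_h \in V_h^{R_j}$, $\vartheta_h \in V_h^{\theta}$. Derivatives in $r$ at $r = R_j$ are understood as one-sided derivatives of these functions from $r > R_j$. No boundary condition is imposed at $r=R_{\oplus}$ in $V_h^{R_j}$ (natural, free surface condition). Discrete eigenfunctions: $\psi^{1},\dots,\psi^{L} \in V_h^{\theta}$ denote the (nonzero) discrete eigenfunctions of the $\sin^3(\theta)$-weighted Laplacian on $V_h^{\theta}$, with eigenvalues $\lambda_1,\dots,\lambda_L$. Discrete Dirichlet-to-Neumann map: for $g_h \in V_h^{\theta}$, let $w_h \in W_h^{R_j}$ be the solution with $w_h(R_j,\cdot) = g_h$ of $$a_{R_j}(w_h,v_h) := \int_{R_j}^{R_{\oplus}} \int_0^{\pi} \left( -\rho r^2\omega^2 w_h v_h + r^2 \mu \frac{\partial w_h}{\partial r}\frac{\partial v_h}{\partial r} + \mu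 \frac{\partial w_h}{\partial \theta}\frac{\partial v_h}{\partial \theta}\right) r^2 \sin^3(\theta)\, d\theta\, dr = 0$$ for all $v_h \in \{ v_h \in W_h^{R_j} \mid v_h(R_j,\cdot) = 0\}$. Then $\mathrm{DtN}_j(g_h) := -(R_j)^4\, \mu(R_j)\, \partial_r w_h(R_j,\cdot)$. It is assumed that $\mathrm{DtN}_j$ is well defined, i.e. that this discrete problem has a unique solution $w_h$ for every $g_h \in V_h^{\theta}$. *)

theory Defs
  imports "HOL-Analysis.Analysis" "HOL-Library.Function_Algebras" "HOL-Computational_Algebra.Polynomial"
begin

text \<open>Pointwise real vector space structure on functions, so that the library's
  \<open>span\<close> applies to function spaces.\<close>

instantiation "fun" :: (type, real_vector) real_vector
begin

definition scaleR_fun :: "real \<Rightarrow> ('a \<Rightarrow> 'b) \<Rightarrow> 'a \<Rightarrow> 'b" where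
  "scaleR_fun c f = (\<lambda>x. c *\<^sub>R f x)"

instance
  by standard (auto simp: scaleR_fun_def fun_eq_iff scaleR_add_right scaleR_add_left)

end

definition mesh :: "real \<Rightarrow> real \<Rightarrow> real list \<Rightarrow> bool" where
  "mesh a b ts \<longleftrightarrow> ts \<noteq> [] \<and> sorted_wrt (<) ts \<and> hd ts = a \<and> last ts = b"

text \<open>Smooth means infinitely often differentiable in the interior of each piece. Jumps are
  allowed, and the values at the finitely many break points are arbitrary.\<close>

definition piecewise_smooth :: "real \<Rightarrow> real \<Rightarrow> (real \<Rightarrow> real) \<Rightarrow> bool" where
  "piecewise_smooth a b f \<longleftrightarrow>
     (\<exists>ts. mesh a b ts \<and>
       (\<forall>i k. Suc i < length ts \<longrightarrow> (deriv ^^ k) f differentiable_on {ts ! i <..< ts ! Suc i}))"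

text \<open>A function on \<open>[a, b]\<close> is represented by its extension by zero to the real line, so that
  equality of such functions is equality on \<open>[a, b]\<close>.\<close>

definition pw_poly :: "real list \<Rightarrow> real \<Rightarrow> real \<Rightarrow> (real \<Rightarrow> real) \<Rightarrow> bool" where
  "pw_poly ts a b f \<longleftrightarrow>
     continuous_on {a..b} f \<and>
     (\<forall>i. Suc i < length ts \<longrightarrow> (\<exists>p. \<forall>x\<in>{ts ! i <..< ts ! Suc i}. f x = poly p x)) \<and>
     (\<forall>x. x \<notin> {a..b} \<longrightarrow> f x = 0)"

text \<open>A conforming finite element space in \<open>H\<^sup>1((a, b))\<close>: a finite-dimensional space of
  continuous piecewise polynomials on a mesh. The polynomial degree is not restricted.\<close>

definition fe_space :: "real \<Rightarrow> real \<Rightarrow> (real \<Rightarrow> real) set \<Rightarrow> bool" where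
  "fe_space a b V \<longleftrightarrow>
     (\<exists>B. finite B \<and> V = span B) \<and> (\<exists>ts. mesh a b ts \<and> (\<forall>f\<in>V. pw_poly ts a b f))"

text \<open>The same in \<open>H\<^sub>0\<^sup>1((a, b))\<close>.\<close>

definition fe_space0 :: "real \<Rightarrow> real \<Rightarrow> (real \<Rightarrow> real) set \<Rightarrow> bool" where
  "fe_space0 a b V \<longleftrightarrow> fe_space a b V \<and> (\<forall>f\<in>V. f a = 0 \<and> f b = 0)"

definition tensor_space ::
  "(real \<Rightarrow> real) set \<Rightarrow> (real \<Rightarrow> real) set \<Rightarrow> (real \<Rightarrow> real \<Rightarrow> real) set" where
  "tensor_space V V' = span {(\<lambda>r \<theta>. R r * \<phi> \<theta>) | R \<phi>. R \<in> V \<and> \<phi> \<in> V'}"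

text \<open>The weak derivative of a continuous piecewise polynomial agrees with its classical
  derivative away from the mesh points; the value of \<open>deriv\<close> at these finitely many points
  does not affect the integrals below.\<close>

definition discrete_eigenpair :: "(real \<Rightarrow> real) set \<Rightarrow> real \<Rightarrow> (real \<Rightarrow> real) \<Rightarrow> bool" where
  "discrete_eigenpair V lam \<psi> \<longleftrightarrow>
     \<psi> \<in> V \<and> \<psi> \<noteq> 0 \<and>
     (\<forall>\<phi>\<in>V. (LBINT \<theta>:{0..pi}. deriv \<psi> \<theta> * deriv \<phi> \<theta> * sin \<theta> ^ 3)
            = lam * (LBINT \<theta>:{0..pi}. \<psi> \<theta> * \<phi> \<theta> * sin \<theta> ^ 3))"

definition radial_form ::
  "(real \<Rightarrow> real) \<Rightarrow> (real \<Rightarrow> real) \<Rightarrow> real \<Rightarrow> real \<Rightarrow> real \<Rightarrow> real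
    \<Rightarrow> (real \<Rightarrow> real) \<Rightarrow> (real \<Rightarrow> real) \<Rightarrow> real" where
  "radial_form \<rho> \<mu> \<omega> R\<^sub>j R\<^sub>E lam u R =
     (LBINT r:{R\<^sub>j..R\<^sub>E}.
        (- \<rho> r * r\<^sup>2 * \<omega>\<^sup>2 * u r * R r + r\<^sup>2 * \<mu> r * deriv u r * deriv R r + lam * \<mu> r * u r * R r) * r\<^sup>2)"

definition radial_solution ::
  "(real \<Rightarrow> real) \<Rightarrow> (real \<Rightarrow> real) \<Rightarrow> real \<Rightarrow> real \<Rightarrow> real \<Rightarrow> (real \<Rightarrow> real) set
    \<Rightarrow> real \<Rightarrow> (real \<Rightarrow> real) \<Rightarrow> bool" where
  "radial_solution \<rho> \<mu> \<omega> R\<^sub>j R\<^sub>E V lam u \<longleftrightarrow>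
     u \<in> V \<and> u R\<^sub>j = 1 \<and>
     (\<forall>R\<in>V. R R\<^sub>j = 0 \<longrightarrow> radial_form \<rho> \<mu> \<omega> R\<^sub>j R\<^sub>E lam u R = 0)"

definition a_form ::
  "(real \<Rightarrow> real) \<Rightarrow> (real \<Rightarrow> real) \<Rightarrow> real \<Rightarrow> real \<Rightarrow> real
    \<Rightarrow> (real \<Rightarrow> real \<Rightarrow> real) \<Rightarrow> (real \<Rightarrow> real \<Rightarrow> real) \<Rightarrow> real" where
  "a_form \<rho> \<mu> \<omega> R\<^sub>j R\<^sub>E w v =
     (LBINT r:{R\<^sub>j..R\<^sub>E}. LBINT \<theta>:{0..pi}.
        (- \<rho> r * r\<^sup>2 * \<omega>\<^sup>2 * w r \<theta> * v r \<theta>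
         + r\<^sup>2 * \<mu> r * deriv (\<lambda>s. w s \<theta>) r * deriv (\<lambda>s. v s \<theta>) r
         + \<mu> r * deriv (w r) \<theta> * deriv (v r) \<theta>) * r\<^sup>2 * sin \<theta> ^ 3)"

definition dirichlet_solution ::
  "(real \<Rightarrow> real) \<Rightarrow> (real \<Rightarrow> real) \<Rightarrow> real \<Rightarrow> real \<Rightarrow> real
    \<Rightarrow> (real \<Rightarrow> real) set \<Rightarrow> (real \<Rightarrow> real) set \<Rightarrow> (real \<Rightarrow> real) \<Rightarrow> (real \<Rightarrow> real \<Rightarrow> real) \<Rightarrow> bool" where
  "dirichlet_solution \<rho> \<mu> \<omega> R\<^sub>j R\<^sub>E V V' g w \<longleftrightarrow>
     w \<in> tensor_space V V' \<and> w R\<^sub>j = g \<and>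
     (\<forall>v\<in>tensor_space V V'. v R\<^sub>j = 0 \<longrightarrow> a_form \<rho> \<mu> \<omega> R\<^sub>j R\<^sub>E w v = 0)"

definition DtN_well_defined ::
  "(real \<Rightarrow> real) \<Rightarrow> (real \<Rightarrow> real) \<Rightarrow> real \<Rightarrow> real \<Rightarrow> real
    \<Rightarrow> (real \<Rightarrow> real) set \<Rightarrow> (real \<Rightarrow> real) set \<Rightarrow> bool" where
  "DtN_well_defined \<rho> \<mu> \<omega> R\<^sub>j R\<^sub>E V V' \<longleftrightarrow>
     (\<forall>g\<in>V'. \<exists>!w. dirichlet_solution \<rho> \<mu> \<omega> R\<^sub>j R\<^sub>E V V' g w)"

definition right_deriv :: "(real \<Rightarrow> real) \<Rightarrow> real \<Rightarrow> real" where
  "right_deriv f x = vector_derivative f (at_right x)"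

definition DtN ::
  "(real \<Rightarrow> real) \<Rightarrow> (real \<Rightarrow> real) \<Rightarrow> real \<Rightarrow> real \<Rightarrow> real
    \<Rightarrow> (real \<Rightarrow> real) set \<Rightarrow> (real \<Rightarrow> real) set \<Rightarrow> (real \<Rightarrow> real) \<Rightarrow> (real \<Rightarrow> real)" where
  "DtN \<rho> \<mu> \<omega> R\<^sub>j R\<^sub>E V V' g =
     (let w = THE w. dirichlet_solution \<rho> \<mu> \<omega> R\<^sub>j R\<^sub>E V V' g w
      in (\<lambda>\<theta>. - (R\<^sub>j ^ 4) * \<mu> R\<^sub>j * right_deriv (\<lambda>r. w r \<theta>) R\<^sub>j))"

end

theory Submission
  imports Defs
begin

text \<open>The product \<open>u(r) \<psi>(\<theta>)\<close> solves the discrete Dirichlet problem with datum \<open>\<psi>\<close>, so by uniqueness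
  it is the solution entering the Dirichlet-to-Neumann map. Testing against a product \<open>R(r) \<phi>(\<theta>)\<close>
  with \<open>R(a) = 0\<close> separates the form: the eigenvalue equation for \<open>\<psi>\<close> turns the inner integral into
  a constant times the integrand of the radial form. Products of this kind span all admissible test
  functions, because subtracting \<open>u \<otimes> v(a,\<sqdot>)\<close> from \<open>v\<close> is the identity on functions vanishing at
  \<open>r = a\<close> and maps \<open>R \<otimes> \<phi>\<close> to \<open>(R - R(a) u) \<otimes> \<phi>\<close>.\<close>

section \<open>Bounded functions with finitely many discontinuities\<close>

text \<open>One class for everything that is integrated: the coefficients, the finite element
  functions and their derivatives. Values on the finite set \<open>S\<close> are free, so jumps of
  the coefficients and the values of \<open>deriv\<close> at mesh points do no harm. The class is
  closed under sums and products, so integrability can be checked by structure.\<close>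

definition pw_bounded_cont :: "real \<Rightarrow> real \<Rightarrow> (real \<Rightarrow> real) \<Rightarrow> bool" where
  "pw_bounded_cont a b f \<longleftrightarrow>
     (\<exists>S. finite S \<and> continuous_on ({a..b} - S) f \<and> bounded (f ` ({a..b} - S)))"

lemma pw_bounded_cont_continuous:
  "continuous_on {a..b} f \<Longrightarrow> pw_bounded_cont a b f"
  unfolding pw_bounded_cont_def
  by (intro exI[of _ "{}"]) (auto intro: compact_imp_bounded compact_continuous_image)

lemma pw_bounded_cont_combine:
  assumes "pw_bounded_cont a b f" "pw_bounded_cont a b g"
  obtains S where "finite S" "continuous_on ({a..b} - S) f" "continuous_on ({a..b} - S) g"
    "bounded (f ` ({a..b} - S))" "bounded (g ` ({a..b} - S))"
proof -
  obtain S T where S: "finite S" "continuous_on ({a..b} - S) f" "bounded (f ` ({a..b} - S))"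
    and T: "finite T" "continuous_on ({a..b} - T) g" "bounded (g ` ({a..b} - T))"
    using assms unfolding pw_bounded_cont_def by blast
  show thesis
  proof
    show "finite (S \<union> T)" using S T by simp
    show "continuous_on ({a..b} - (S \<union> T)) f" "continuous_on ({a..b} - (S \<union> T)) g"
      using S T by (auto elim: continuous_on_subset)
    show "bounded (f ` ({a..b} - (S \<union> T)))" "bounded (g ` ({a..b} - (S \<union> T)))"
      by (rule bounded_subset[OF S(3)], blast) (rule bounded_subset[OF T(3)], blast)
  qed
qed

lemma pw_bounded_cont_add:
  assumes "pw_bounded_cont a b f" "pw_bounded_cont a b g"
  shows "pw_bounded_cont a b (\<lambda>x. f x + g x)"
proof -
  obtain S where S: "finite S" "continuous_on ({a..b} - S) f" "continuous_on ({a..b} - S) g"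
    "bounded (f ` ({a..b} - S))" "bounded (g ` ({a..b} - S))"
    using pw_bounded_cont_combine[OF assms] .
  have "bounded ((\<lambda>x. f x + g x) ` ({a..b} - S))"
    using S by (intro bounded_plus_comp)
  with S show ?thesis
    unfolding pw_bounded_cont_def by (blast intro: continuous_on_add)
qed

lemma pw_bounded_cont_mult:
  assumes "pw_bounded_cont a b f" "pw_bounded_cont a b g"
  shows "pw_bounded_cont a b (\<lambda>x. f x * g x)"
proof -
  obtain S where S: "finite S" "continuous_on ({a..b} - S) f" "continuous_on ({a..b} - S) g"
    "bounded (f ` ({a..b} - S))" "bounded (g ` ({a..b} - S))"
    using pw_bounded_cont_combine[OF assms] .
  obtain B C where "\<And>x. x \<in> {a..b} - S \<Longrightarrow> \<bar>f x\<bar> \<le> B" "\<And>x. x \<in> {a..b} - S \<Longrightarrow> \<bar>g x\<bar> \<le> C"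
    using S(4,5) unfolding bounded_iff ball_simps real_norm_def by blast
  then have "\<bar>f x * g x\<bar> \<le> B * C" if "x \<in> {a..b} - S" for x
    unfolding abs_mult using that by (intro mult_mono) (auto intro: order_trans[OF abs_ge_zero])
  then have "bounded ((\<lambda>x. f x * g x) ` ({a..b} - S))"
    by (intro boundedI[where B = "B * C"]) auto
  with S show ?thesis
    unfolding pw_bounded_cont_def by (blast intro: continuous_on_mult)
qed

lemma pw_bounded_cont_uminus:
  "pw_bounded_cont a b f \<Longrightarrow> pw_bounded_cont a b (\<lambda>x. - f x)"
  using pw_bounded_cont_mult[OF pw_bounded_cont_continuous[of a b "\<lambda>_. - 1"], of f] by simp

lemma set_integrable_pw_bounded_cont:
  assumes "pw_bounded_cont a b f"
  shows "set_integrable lborel {a..b} f"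
proof -
  obtain S where S: "finite S" "continuous_on ({a..b} - S) f" "bounded (f ` ({a..b} - S))"
    using assms unfolding pw_bounded_cont_def by blast
  obtain B where B: "\<And>x. x \<in> {a..b} - S \<Longrightarrow> \<bar>f x\<bar> \<le> B"
    using S(3) unfolding bounded_iff ball_simps real_norm_def by blast
  let ?A = "{a..b} - S"
  have A: "?A \<in> sets borel"
    using S(1) by (intro sets.Diff) (auto intro: finite_imp_closed borel_closed)
  have "emeasure lborel ?A \<le> emeasure lborel {a..b}"
    by (rule emeasure_mono) auto
  also have "\<dots> < \<infinity>"
    by (cases "a \<le> b") auto
  finally have "emeasure lborel ?A < \<infinity>" .
  \<comment> \<open>Only the extension of \<open>f\<close> by zero off \<open>?A\<close> is known to
    be Borel measurable, so it takes the place of \<open>f\<close> as the integrand. The doubled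
    indicator collapses afterwards.\<close>
  then have "integrable lborel (\<lambda>x. indicator ?A x *\<^sub>R (indicator ?A x *\<^sub>R f x))"
    using B A borel_measurable_continuous_on_indicator[OF A S(2)]
    by (intro integrableI_bounded_set_indicator[where B = B]) auto
  moreover have "indicator ?A x *\<^sub>R (indicator ?A x *\<^sub>R f x) = indicator ?A x *\<^sub>R f x" for x
    by (auto simp: indicator_def)
  ultimately have "set_integrable lborel ?A f"
    unfolding set_integrable_def by (simp only:)
  also have "?this \<longleftrightarrow> set_integrable lborel {a..b} f"
    using S(1) by (intro set_integrable_discrete_difference[where X = S]) (auto intro: countable_finite)
  finally show ?thesis .
qed

text \<open>Finite sets are null for \<open>lborel\<close>, and no integrability is asked for. This
  allows derivatives inside integrals to be computed away from mesh points only.\<close>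

lemma set_lebesgue_integral_cong_finite:
  fixes f g :: "real \<Rightarrow> real"
  assumes "finite S" "\<And>x. x \<in> A - S \<Longrightarrow> f x = g x"
  shows "(LBINT x:A. f x) = (LBINT x:A. g x)"
  unfolding set_lebesgue_integral_def
  using assms by (intro integral_discrete_difference[where X = S])
    (auto intro: countable_finite simp: indicator_def)

lemma set_lebesgue_integral_sum_pw:
  assumes "finite I" "\<And>i. i \<in> I \<Longrightarrow> pw_bounded_cont a b (f i)"
  shows "(LBINT x:{a..b}. \<Sum>i\<in>I. f i x) = (\<Sum>i\<in>I. LBINT x:{a..b}. f i x)"
  unfolding set_lebesgue_integral_def sum_distrib_left real_scaleR_def
  using set_integrable_pw_bounded_cont[OF assms(2)]
  by (intro Bochner_Integration.integral_sum) (simp add: set_integrable_def)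

section \<open>Piecewise polynomials\<close>

lemma mesh_piece:
  assumes "mesh a b ts" "x \<in> {a..b} - set ts"
  obtains i where "Suc i < length ts" "x \<in> {ts ! i <..< ts ! Suc i}"
proof -
  have ne: "ts \<noteq> []" and ends: "ts ! 0 = a" "ts ! (length ts - 1) = b"
    using assms(1) by (auto simp: mesh_def hd_conv_nth last_conv_nth)
  \<comment> \<open>The right end of the piece is the first mesh point beyond \<open>x\<close>. It
    is not the point of index 0 because \<open>a\<close> is at most \<open>x\<close>; its
    predecessor is at most \<open>x\<close>, and strictly less because \<open>x\<close> is not a
    mesh point.\<close>
  define n where "n = (LEAST n. n < length ts \<and> x < ts ! n)"
  have "b \<in> set ts" using ne ends(2) nth_mem[of "length ts - 1" ts] by simp
  then have "x < b" using assms(2) by (auto simp: less_le)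
  then have "length ts - 1 < length ts \<and> x < ts ! (length ts - 1)"
    using ne ends(2) by simp
  then have n: "n < length ts" "x < ts ! n"
    unfolding n_def by (rule LeastI2, simp)+
  have "n \<noteq> 0"
    using n(2) ends assms(2) by (cases n) auto
  then obtain i where i: "n = Suc i" by (cases n) auto
  have "\<not> (i < length ts \<and> x < ts ! i)"
    using not_less_Least[of i "\<lambda>n. n < length ts \<and> x < ts ! n"] i n_def by simp
  then have "ts ! i < x"
    using i n assms(2) nth_mem[of i ts] by (auto simp: less_le not_less)
  then show thesis using that i n by auto
qed

lemma continuous_on_mesh:
  fixes f :: "real \<Rightarrow> real"
  assumes "mesh a b ts"
    and "\<And>i. Suc i < length ts \<Longrightarrow> continuous_on {ts ! i <..< ts ! Suc i} f"
  shows "continuous_on ({a..b} - set ts) f"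
proof (rule continuous_at_imp_continuous_on, rule ballI)
  fix x assume "x \<in> {a..b} - set ts"
  then obtain i where "Suc i < length ts" "x \<in> {ts ! i <..< ts ! Suc i}"
    using mesh_piece[OF assms(1)] by blast
  then show "isCont f x"
    using assms(2) continuous_on_eq_continuous_at open_greaterThanLessThan by blast
qed

text \<open>Smoothness on open pieces allows blow-up at the break points, so boundedness enters as a
  separate assumption. Continuity is the case \<open>k = 0\<close>, where the iterated derivative is
  \<open>f\<close> itself.\<close>

lemma piecewise_smooth_pw_bounded_cont:
  assumes "piecewise_smooth a b f" "bounded (f ` {a..b})"
  shows "pw_bounded_cont a b f"
proof -
  obtain ts where ts: "mesh a b ts"
    and d: "\<And>i k. Suc i < length ts \<Longrightarrow> (deriv ^^ k) f differentiable_on {ts ! i <..< ts ! Suc i}"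
    using assms(1) unfolding piecewise_smooth_def by blast
  have "continuous_on ({a..b} - set ts) f"
    using continuous_on_mesh[OF ts] d[of _ 0] by (simp add: differentiable_imp_continuous_on)
  moreover have "bounded (f ` ({a..b} - set ts))"
    by (rule bounded_subset[OF assms(2)]) auto
  ultimately show ?thesis
    unfolding pw_bounded_cont_def by blast
qed

lemma pw_poly_has_derivative:
  assumes "pw_poly ts a b f" "Suc i < length ts"
  obtains p where "\<And>x. x \<in> {ts ! i <..< ts ! Suc i} \<Longrightarrow> f x = poly p x"
    "\<And>x. x \<in> {ts ! i <..< ts ! Suc i} \<Longrightarrow> (f has_real_derivative poly (pderiv p) x) (at x)"
proof -
  obtain p where p: "\<And>x. x \<in> {ts ! i <..< ts ! Suc i} \<Longrightarrow> f x = poly p x"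
    using assms unfolding pw_poly_def by blast
  have "(f has_real_derivative poly (pderiv p) x) (at x)" if "x \<in> {ts ! i <..< ts ! Suc i}" for x
    by (rule has_field_derivative_transform_within_open[OF poly_DERIV _ that]) (use p in auto)
  with p that show thesis by blast
qed

lemma pw_poly_DERIV_deriv:
  assumes "mesh a b ts" "pw_poly ts a b f" "x \<in> {a..b} - set ts"
  shows "(f has_real_derivative deriv f x) (at x)"
  using mesh_piece[OF assms(1,3)] pw_poly_has_derivative[OF assms(2)] DERIV_imp_deriv by metis

lemma pw_poly_pw_bounded_cont:
  "pw_poly ts a b f \<Longrightarrow> pw_bounded_cont a b f"
  by (simp add: pw_poly_def pw_bounded_cont_continuous)

text \<open>On each open piece the derivative is a polynomial, which is bounded on the compact
  closure of the piece; there are finitely many pieces.\<close>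

lemma pw_poly_deriv_pw_bounded_cont:
  assumes ts: "mesh a b ts" and f: "pw_poly ts a b f"
  shows "pw_bounded_cont a b (deriv f)"
proof -
  have piece: "continuous_on {ts ! i <..< ts ! Suc i} (deriv f) \<and>
    bounded (deriv f ` {ts ! i <..< ts ! Suc i})" if i: "Suc i < length ts" for i
  proof -
    let ?J = "{ts ! i <..< ts ! Suc i}"
    obtain p where "\<And>x. x \<in> ?J \<Longrightarrow> (f has_real_derivative poly (pderiv p) x) (at x)"
      using pw_poly_has_derivative[OF f i] by blast
    then have eq: "deriv f x = poly (pderiv p) x" if "x \<in> ?J" for x
      using that DERIV_imp_deriv by blast
    have "continuous_on ?J (deriv f) \<longleftrightarrow> continuous_on ?J (poly (pderiv p))"
      using eq by (intro continuous_on_cong) auto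
    moreover have "deriv f ` ?J \<subseteq> poly (pderiv p) ` {ts ! i..ts ! Suc i}"
      using eq by auto
    moreover have "bounded (poly (pderiv p) ` {ts ! i..ts ! Suc i})"
      by (intro compact_imp_bounded compact_continuous_image continuous_intros) auto
    ultimately show ?thesis
      using bounded_subset by (auto intro!: continuous_intros)
  qed
  have "deriv f ` ({a..b} - set ts)
      \<subseteq> (\<Union>i\<in>{i. Suc i < length ts}. deriv f ` {ts ! i <..< ts ! Suc i})"
    using mesh_piece[OF ts] by blast
  moreover have "finite {i. Suc i < length ts}"
    by (rule finite_subset[of _ "{..<length ts}"]) auto
  then have "bounded (\<Union>i\<in>{i. Suc i < length ts}. deriv f ` {ts ! i <..< ts ! Suc i})"
    using piece by (intro bounded_UN) auto
  ultimately have "bounded (deriv f ` ({a..b} - set ts))"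
    by (rule bounded_subset[rotated])
  then show ?thesis
    unfolding pw_bounded_cont_def using continuous_on_mesh[OF ts] piece by blast
qed

text \<open>\<open>right_deriv\<close> is defined by a choice, which is meaningful only where a
  one-sided derivative exists. It exists here because, by continuity, \<open>f\<close> agrees with
  the polynomial of the first piece at \<open>a\<close> as well.\<close>

lemma pw_poly_right_deriv:
  assumes ts: "mesh a b ts" and f: "pw_poly ts a b f" and "a < b"
  shows "(f has_real_derivative right_deriv f a) (at_right a)"
proof -
  have len: "Suc 0 < length ts"
    using ts \<open>a < b\<close> by (cases ts; cases "tl ts") (auto simp: mesh_def)
  define c where "c = ts ! Suc 0"
  have a: "ts ! 0 = a" and "a < c"
    using ts len sorted_wrt_nth_less[of "(<)" ts 0 "Suc 0"]
    by (auto simp: mesh_def hd_conv_nth c_def)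
  have "c \<le> b"
  proof -
    have "b = ts ! (length ts - 1)" using ts last_conv_nth[of ts] by (simp add: mesh_def)
    moreover have "ts ! Suc 0 \<le> ts ! (length ts - 1)"
      using ts len sorted_wrt_nth_less[of "(<)" ts "Suc 0" "length ts - 1"]
      by (cases "Suc 0 < length ts - 1") (auto simp: mesh_def not_less dest!: le_antisym)
    ultimately show ?thesis by (simp add: c_def)
  qed
  obtain p where p: "\<And>x. x \<in> {a <..< c} \<Longrightarrow> f x = poly p x"
    using pw_poly_has_derivative[OF f len] a c_def by metis
  have cf: "continuous_on {a..b} f" using f by (simp add: pw_poly_def)
  \<comment> \<open>Both \<open>f\<close> and \<open>poly p\<close> converge to their values at
    \<open>a\<close> from the right, and they coincide just right of \<open>a\<close>; uniqueness of
    limits gives \<open>f a = poly p a\<close>.\<close>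
  have "(f \<longlongrightarrow> f a) (at_right a)"
    using cf \<open>a < b\<close> continuous_on_Icc_at_rightD by blast
  moreover have "(poly p \<longlongrightarrow> poly p a) (at_right a)"
    by (rule tendsto_intros) (rule tendsto_ident_at)
  moreover have ev: "eventually (\<lambda>x. poly p x = f x) (at_right a)"
    using eventually_at_right_real[OF \<open>a < c\<close>] by (rule eventually_mono) (simp add: p)
  ultimately have fa: "f a = poly p a"
    using tendsto_unique[OF trivial_limit_at_right_real] tendsto_cong by metis
  have "(poly p has_real_derivative poly (pderiv p) a) (at_right a)"
    by (rule DERIV_subset[OF poly_DERIV]) simp
  then have d: "(f has_real_derivative poly (pderiv p) a) (at_right a)"
    using has_field_derivative_cong_eventually[OF ev] fa by metis
  then have "right_deriv f a = poly (pderiv p) a"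
    unfolding right_deriv_def has_real_derivative_iff_has_vector_derivative
    by (intro vector_derivative_within) simp_all
  with d show ?thesis by simp
qed

section \<open>Tensor products\<close>

lemma sum_fun_apply:
  fixes f :: "'i \<Rightarrow> 'a \<Rightarrow> 'b::comm_monoid_add"
  shows "sum f A x = (\<Sum>i\<in>A. f i x)"
  by (induction A rule: infinite_finite_induct) auto

text \<open>A span element is a finite combination of generators. The generators serve as their own
  index set, and the scalars are absorbed into the radial factors, which stay in the subspace
  \<open>V\<close>.\<close>

lemma tensor_space_explicit:
  assumes V: "subspace V" and v: "v \<in> tensor_space V V'"
  obtains I :: "(real \<Rightarrow> real \<Rightarrow> real) set" and R \<phi>
  where "finite I" "\<And>i. i \<in> I \<Longrightarrow> R i \<in> V" "\<And>i. i \<in> I \<Longrightarrow> \<phi> i \<in> V'"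
    "v = (\<lambda>r \<theta>. \<Sum>i\<in>I. R i r * \<phi> i \<theta>)"
proof -
  let ?T = "{(\<lambda>r \<theta>. R r * \<phi> \<theta>) | R \<phi>. R \<in> V \<and> \<phi> \<in> V'}"
  obtain I c where I: "finite I" "I \<subseteq> ?T" and veq: "v = (\<Sum>i\<in>I. c i *\<^sub>R i)"
    using v unfolding tensor_space_def span_explicit by blast
  have "\<forall>i\<in>I. \<exists>R \<phi>. R \<in> V \<and> \<phi> \<in> V' \<and> i = (\<lambda>r \<theta>. R r * \<phi> \<theta>)"
    using I(2) by blast
  then obtain R \<phi> where R: "\<And>i. i \<in> I \<Longrightarrow> R i \<in> V" "\<And>i. i \<in> I \<Longrightarrow> \<phi> i \<in> V'"
    "\<And>i. i \<in> I \<Longrightarrow> i = (\<lambda>r \<theta>. R i r * \<phi> i \<theta>)"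
    by metis
  show thesis
  proof
    show "finite I" by fact
    show "(c i *\<^sub>R R i) \<in> V" if "i \<in> I" for i
      using V R(1)[OF that] by (simp add: subspace_def)
    show "\<phi> i \<in> V'" if "i \<in> I" for i using R(2)[OF that] .
    have "(c i *\<^sub>R i) r \<theta> = (c i *\<^sub>R R i) r * \<phi> i \<theta>" if "i \<in> I" for i r \<theta>
      by (subst R(3)[OF that]) (simp add: scaleR_fun_def)
    then show "v = (\<lambda>r \<theta>. \<Sum>i\<in>I. (c i *\<^sub>R R i) r * \<phi> i \<theta>)"
      unfolding veq by (simp add: fun_eq_iff sum_fun_apply)
  qed
qed

text \<open>A vanishing trace constrains only the sum of products, while the radial equation needs
  every single radial factor to vanish at \<open>a\<close>. The projection \<open>P\<close> provides
  such a representation.\<close>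

lemma tensor_space_vanishing:
  assumes V: "subspace V" and u: "u \<in> V" "u a = 1"
    and v: "v \<in> tensor_space V V'" "v a = 0"
  shows "v \<in> tensor_space {R\<in>V. R a = 0} V'"
proof -
  let ?W = "tensor_space {R\<in>V. R a = 0} V'"
  define P where "P v = v - (\<lambda>r \<theta>. u r * v a \<theta>)" for v :: "real \<Rightarrow> real \<Rightarrow> real"
  have W: "subspace ?W" unfolding tensor_space_def by (rule subspace_span)
  have "P v \<in> ?W"
    using v(1) unfolding tensor_space_def[of V]
  proof (induction rule: span_induct)
    \<comment> \<open>The induction asks that the functions sent into \<open>?W\<close> by
      \<open>P\<close> form a subspace, which follows from linearity of \<open>P\<close>.\<close>
    case base
    have "P 0 = 0"
      by (simp add: P_def fun_eq_iff)
    moreover have "P (x + y) = P x + P y" for x y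
      by (simp add: P_def fun_eq_iff algebra_simps)
    moreover have "P (c *\<^sub>R x) = c *\<^sub>R P x" for c x
      by (simp add: P_def fun_eq_iff scaleR_fun_def algebra_simps)
    ultimately show ?case
      using W by (simp add: subspace_def)
  next
    case (step x)
    then obtain R \<phi> where x: "R \<in> V" "\<phi> \<in> V'" "x = (\<lambda>r \<theta>. R r * \<phi> \<theta>)" by blast
    have "R - R a *\<^sub>R u \<in> {R\<in>V. R a = 0}"
    proof (intro CollectI conjI)
      show "R - R a *\<^sub>R u \<in> V"
        using V x(1) u(1) by (intro subspace_diff subspace_scale)
    qed (simp add: scaleR_fun_def u)
    moreover have "P x = (\<lambda>r \<theta>. (R - R a *\<^sub>R u) r * \<phi> \<theta>)"
      by (simp add: P_def x(3) fun_eq_iff scaleR_fun_def algebra_simps)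
    ultimately show ?case
      unfolding tensor_space_def using x(2) by (blast intro: span_base)
  qed
  moreover have "P v = v"
    using v(2) by (simp add: P_def fun_eq_iff)
  ultimately show ?thesis by simp
qed

section \<open>Separation of variables\<close>

text \<open>Fubini is not involved: for fixed \<open>r\<close> the integral over \<theta> is
  evaluated term by term, and the integral over \<open>r\<close> is then that of a finite sum of
  multiples of radial integrands.\<close>

lemma a_form_product_sum:
  assumes \<rho>: "pw_bounded_cont a b \<rho>" and \<mu>: "pw_bounded_cont a b \<mu>"
    and ts: "mesh a b ts" and V: "\<And>f. f \<in> V \<Longrightarrow> pw_poly ts a b f"
    and ts': "mesh 0 pi ts'" and V': "\<And>f. f \<in> V' \<Longrightarrow> pw_poly ts' 0 pi f"
    and \<psi>: "discrete_eigenpair V' lam \<psi>"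
    and u: "u \<in> V" and I: "finite I" and R: "\<And>i. i \<in> I \<Longrightarrow> R i \<in> V"
    and \<phi>: "\<And>i. i \<in> I \<Longrightarrow> \<phi> i \<in> V'"
  shows "a_form \<rho> \<mu> \<omega> a b (\<lambda>r \<theta>. u r * \<psi> \<theta>) (\<lambda>r \<theta>. \<Sum>i\<in>I. R i r * \<phi> i \<theta>)
    = (\<Sum>i\<in>I. (LBINT \<theta>:{0..pi}. \<psi> \<theta> * \<phi> i \<theta> * sin \<theta> ^ 3) * radial_form \<rho> \<mu> \<omega> a b lam u (R i))"
proof -
  note pw = pw_bounded_cont_add pw_bounded_cont_mult pw_bounded_cont_uminus
    pw_poly_deriv_pw_bounded_cont[OF ts V] pw_poly_deriv_pw_bounded_cont[OF ts' V']
    pw_poly_pw_bounded_cont[OF V] pw_poly_pw_bounded_cont[OF V']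
  have V\<psi>: "\<psi> \<in> V'" using \<psi> by (simp add: discrete_eigenpair_def)
  have sin3: "pw_bounded_cont 0 pi (\<lambda>\<theta>. sin \<theta> ^ 3)" and const: "pw_bounded_cont 0 pi (\<lambda>_. c)"
    and r2: "pw_bounded_cont a b (\<lambda>r. r\<^sup>2)" and const': "pw_bounded_cont a b (\<lambda>_. c)" for c
    by (intro pw_bounded_cont_continuous continuous_intros)+
  define M where "M i = (LBINT \<theta>:{0..pi}. \<psi> \<theta> * \<phi> i \<theta> * sin \<theta> ^ 3)" for i
  \<comment> \<open>For fixed \<open>r\<close>, \<open>A i r\<close> is the factor of the angular
    mass integrand and \<open>B i r\<close> that of the angular stiffness integrand. Their
    combination \<open>G i r\<close> is the integrand of \<open>radial_form\<close>.\<close>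
  define A where
    "A i r = (- \<rho> r * r\<^sup>2 * \<omega>\<^sup>2 * u r * R i r + r\<^sup>2 * \<mu> r * deriv u r * deriv (R i) r) * r\<^sup>2" for i r
  define B where "B i r = \<mu> r * u r * R i r * r\<^sup>2" for i r
  define G where "G i r = (A i r + lam * B i r)" for i r
  have inner: "(LBINT \<theta>:{0..pi}.
        (- \<rho> r * r\<^sup>2 * \<omega>\<^sup>2 * (u r * \<psi> \<theta>) * (\<Sum>i\<in>I. R i r * \<phi> i \<theta>)
         + r\<^sup>2 * \<mu> r * deriv (\<lambda>s. u s * \<psi> \<theta>) r * deriv (\<lambda>s. \<Sum>i\<in>I. R i s * \<phi> i \<theta>) r
         + \<mu> r * deriv (\<lambda>\<theta>. u r * \<psi> \<theta>) \<theta> * deriv (\<lambda>\<theta>. \<Sum>i\<in>I. R i r * \<phi> i \<theta>) \<theta>) * r\<^sup>2 * sin \<theta> ^ 3)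
      = (\<Sum>i\<in>I. M i * G i r)" (is "?L = _")
    if r: "r \<in> {a..b} - set ts" for r
  proof -
    have du: "deriv (\<lambda>s. u s * c) r = deriv u r * c" for c
      using pw_poly_DERIV_deriv[OF ts V[OF u] r]
      by (intro DERIV_imp_deriv) (auto intro!: derivative_eq_intros)
    have dR: "deriv (\<lambda>s. \<Sum>i\<in>I. R i s * c i) r = (\<Sum>i\<in>I. deriv (R i) r * c i)" for c
      using pw_poly_DERIV_deriv[OF ts V[OF R] r]
      by (intro DERIV_imp_deriv DERIV_sum DERIV_cmult_right)
    have "?L = (LBINT \<theta>:{0..pi}. \<Sum>i\<in>I. (\<psi> \<theta> * \<phi> i \<theta> * sin \<theta> ^ 3) * A i r
        + (deriv \<psi> \<theta> * deriv (\<phi> i) \<theta> * sin \<theta> ^ 3) * B i r)"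
    \<comment> \<open>Off the angular mesh points all \<theta>-derivatives exist, and the integrand
      can be expanded over \<open>I\<close>.\<close>
    proof (rule set_lebesgue_integral_cong_finite[OF finite_set[of ts']], goal_cases)
      case (1 \<theta>)
      have d\<psi>: "deriv (\<lambda>\<theta>. u r * \<psi> \<theta>) \<theta> = u r * deriv \<psi> \<theta>"
        using pw_poly_DERIV_deriv[OF ts' V'[OF V\<psi>] 1]
        by (intro DERIV_imp_deriv DERIV_cmult)
      have d\<phi>: "deriv (\<lambda>\<theta>. \<Sum>i\<in>I. R i r * \<phi> i \<theta>) \<theta> = (\<Sum>i\<in>I. R i r * deriv (\<phi> i) \<theta>)"
        using pw_poly_DERIV_deriv[OF ts' V'[OF \<phi>] 1]
        by (intro DERIV_imp_deriv DERIV_sum DERIV_cmult)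
      show ?case
        unfolding du dR d\<psi> d\<phi> A_def B_def sum_distrib_left sum_distrib_right
          sum.distrib[symmetric]
        by (intro sum.cong refl) (simp add: algebra_simps)
    qed
    also have "\<dots> = (\<Sum>i\<in>I. LBINT \<theta>:{0..pi}. (\<psi> \<theta> * \<phi> i \<theta> * sin \<theta> ^ 3) * A i r
        + (deriv \<psi> \<theta> * deriv (\<phi> i) \<theta> * sin \<theta> ^ 3) * B i r)"
      by (intro set_lebesgue_integral_sum_pw I sin3 const pw V\<psi> \<phi>)
    also have "\<dots> = (\<Sum>i\<in>I. M i * G i r)"
    proof (intro sum.cong refl)
      fix i assume i: "i \<in> I"
      have int: "set_integrable lborel {0..pi} (\<lambda>\<theta>. (\<psi> \<theta> * \<phi> i \<theta> * sin \<theta> ^ 3) * A i r)"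
        "set_integrable lborel {0..pi} (\<lambda>\<theta>. (deriv \<psi> \<theta> * deriv (\<phi> i) \<theta> * sin \<theta> ^ 3) * B i r)"
        by (intro set_integrable_pw_bounded_cont sin3 const pw V\<psi> \<phi> i)+
      \<comment> \<open>The eigenvalue equation, tested with \<open>\<phi> i\<close>, trades the
        stiffness integral for \<open>lam\<close> times the mass integral \<open>M i\<close>; this
        produces the term with \<open>lam\<close> in \<open>radial_form\<close>.\<close>
      have eig: "(LBINT \<theta>:{0..pi}. deriv \<psi> \<theta> * deriv (\<phi> i) \<theta> * sin \<theta> ^ 3) = lam * M i"
        using \<psi> \<phi>[OF i] unfolding discrete_eigenpair_def M_def by blast
      show "(LBINT \<theta>:{0..pi}. (\<psi> \<theta> * \<phi> i \<theta> * sin \<theta> ^ 3) * A i r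
          + (deriv \<psi> \<theta> * deriv (\<phi> i) \<theta> * sin \<theta> ^ 3) * B i r) = M i * G i r"
        unfolding set_integral_add(2)[OF int] set_integral_mult_left eig M_def[symmetric] G_def
        by (simp add: algebra_simps)
    qed
    finally show ?thesis .
  qed
  have "a_form \<rho> \<mu> \<omega> a b (\<lambda>r \<theta>. u r * \<psi> \<theta>) (\<lambda>r \<theta>. \<Sum>i\<in>I. R i r * \<phi> i \<theta>)
      = (LBINT r:{a..b}. \<Sum>i\<in>I. M i * G i r)"
    unfolding a_form_def
    by (rule set_lebesgue_integral_cong_finite[OF finite_set[of ts] inner])
  also have "\<dots> = (\<Sum>i\<in>I. LBINT r:{a..b}. M i * G i r)"
    unfolding G_def A_def B_def
    by (intro set_lebesgue_integral_sum_pw I \<rho> \<mu> r2 const' pw u R)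
  also have "\<dots> = (\<Sum>i\<in>I. M i * radial_form \<rho> \<mu> \<omega> a b lam u (R i))"
    unfolding set_integral_mult_right radial_form_def G_def A_def B_def
    by (simp add: algebra_simps)
  finally show ?thesis unfolding M_def .
qed

text \<open>A test function with zero trace is a sum of products whose radial factors are admissible
  in the radial problem, so every term of the separated form vanishes.\<close>

lemma dirichlet_solution_product:
  assumes \<rho>: "pw_bounded_cont a b \<rho>" and \<mu>: "pw_bounded_cont a b \<mu>"
    and V: "fe_space a b V" and V': "fe_space 0 pi V'"
    and \<psi>: "discrete_eigenpair V' lam \<psi>"
    and u: "radial_solution \<rho> \<mu> \<omega> a b V lam u"
  shows "dirichlet_solution \<rho> \<mu> \<omega> a b V V' \<psi> (\<lambda>r \<theta>. u r * \<psi> \<theta>)"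
  unfolding dirichlet_solution_def
proof (intro conjI ballI impI)
  have uV: "u \<in> V" "u a = 1"
    and u0: "\<And>R. R \<in> V \<Longrightarrow> R a = 0 \<Longrightarrow> radial_form \<rho> \<mu> \<omega> a b lam u R = 0"
    using u by (auto simp: radial_solution_def)
  have \<psi>V: "\<psi> \<in> V'" using \<psi> by (simp add: discrete_eigenpair_def)
  show "(\<lambda>r \<theta>. u r * \<psi> \<theta>) \<in> tensor_space V V'"
    unfolding tensor_space_def using uV \<psi>V by (intro span_base) blast
  show "(\<lambda>\<theta>. u a * \<psi> \<theta>) = \<psi>" by (simp add: uV)
  fix v assume v: "v \<in> tensor_space V V'" "v a = 0"
  obtain ts where ts: "mesh a b ts" "\<And>f. f \<in> V \<Longrightarrow> pw_poly ts a b f"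
    using V by (auto simp: fe_space_def)
  obtain ts' where ts': "mesh 0 pi ts'" "\<And>f. f \<in> V' \<Longrightarrow> pw_poly ts' 0 pi f"
    using V' by (auto simp: fe_space_def)
  have sV: "subspace V" using V by (auto simp: fe_space_def)
  then have sV0: "subspace {R\<in>V. R a = 0}"
    by (simp add: subspace_def scaleR_fun_def)
  obtain I :: "(real \<Rightarrow> real \<Rightarrow> real) set" and R \<phi> where I: "finite I"
    and R: "\<And>i. i \<in> I \<Longrightarrow> R i \<in> {R\<in>V. R a = 0}" and \<phi>: "\<And>i. i \<in> I \<Longrightarrow> \<phi> i \<in> V'"
    and veq: "v = (\<lambda>r \<theta>. \<Sum>i\<in>I. R i r * \<phi> i \<theta>)"
    using tensor_space_explicit[OF sV0 tensor_space_vanishing[OF sV uV v]] by blast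
  have R': "R i \<in> V" "R i a = 0" if "i \<in> I" for i using R[OF that] by auto
  show "a_form \<rho> \<mu> \<omega> a b (\<lambda>r \<theta>. u r * \<psi> \<theta>) v = 0"
    unfolding veq
    by (subst a_form_product_sum[OF \<rho> \<mu> ts ts' \<psi> uV(1) I]) (simp_all add: u0 R' \<phi>)
qed

theorem proposition1:
  fixes R\<^sub>j R\<^sub>E \<omega> :: real and \<rho> \<mu> :: "real \<Rightarrow> real"
    and V\<^sub>r V\<^sub>\<theta> :: "(real \<Rightarrow> real) set"
    and L l :: nat and \<psi> :: "nat \<Rightarrow> real \<Rightarrow> real" and lam :: "nat \<Rightarrow> real"
    and u :: "real \<Rightarrow> real"
  assumes "0 < R\<^sub>j" and "R\<^sub>j < R\<^sub>E"
    and "bounded (\<rho> ` {R\<^sub>j..R\<^sub>E})" and "piecewise_smooth R\<^sub>j R\<^sub>E \<rho>"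
    and "bounded (\<mu> ` {R\<^sub>j..R\<^sub>E})" and "piecewise_smooth R\<^sub>j R\<^sub>E \<mu>"
    and "fe_space R\<^sub>j R\<^sub>E V\<^sub>r" and "fe_space0 0 pi V\<^sub>\<theta>"
    and "DtN_well_defined \<rho> \<mu> \<omega> R\<^sub>j R\<^sub>E V\<^sub>r V\<^sub>\<theta>"
    and "\<forall>k\<in>{1..L}. discrete_eigenpair V\<^sub>\<theta> (lam k) (\<psi> k)"
    and "l \<in> {1..L}"
    and "radial_solution \<rho> \<mu> \<omega> R\<^sub>j R\<^sub>E V\<^sub>r (lam l) u"
  shows "DtN \<rho> \<mu> \<omega> R\<^sub>j R\<^sub>E V\<^sub>r V\<^sub>\<theta> (\<psi> l)
       = (\<lambda>\<theta>. - (R\<^sub>j ^ 4) * \<mu> R\<^sub>j * right_deriv u R\<^sub>j * \<psi> l \<theta>)"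
proof -
  let ?w = "\<lambda>r \<theta>. u r * \<psi> l \<theta>"
  have eig: "discrete_eigenpair V\<^sub>\<theta> (lam l) (\<psi> l)" using assms(10,11) by blast
  have V': "fe_space 0 pi V\<^sub>\<theta>" using assms(8) by (simp add: fe_space0_def)
  have sol: "dirichlet_solution \<rho> \<mu> \<omega> R\<^sub>j R\<^sub>E V\<^sub>r V\<^sub>\<theta> (\<psi> l) ?w"
    by (rule dirichlet_solution_product[OF
          piecewise_smooth_pw_bounded_cont[OF assms(4,3)]
          piecewise_smooth_pw_bounded_cont[OF assms(6,5)] assms(7) V' eig assms(12)])
  have "\<exists>!w. dirichlet_solution \<rho> \<mu> \<omega> R\<^sub>j R\<^sub>E V\<^sub>r V\<^sub>\<theta> (\<psi> l) w"
    using assms(9) eig unfolding DtN_well_defined_def discrete_eigenpair_def by blast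
  \<comment> \<open>Well-posedness for the datum \<open>\<psi> l\<close> makes the definite
    description in \<open>DtN\<close> denote the product.\<close>
  then have w: "(THE w. dirichlet_solution \<rho> \<mu> \<omega> R\<^sub>j R\<^sub>E V\<^sub>r V\<^sub>\<theta> (\<psi> l) w) = ?w"
    by (rule the1_equality) (rule sol)
  obtain ts where "mesh R\<^sub>j R\<^sub>E ts" "pw_poly ts R\<^sub>j R\<^sub>E u"
    using assms(7,12) by (auto simp: fe_space_def radial_solution_def)
  then have "(u has_real_derivative right_deriv u R\<^sub>j) (at_right R\<^sub>j)"
    using assms(2) by (rule pw_poly_right_deriv)
  \<comment> \<open>For fixed \<theta> the factor \<open>\<psi> l \<theta>\<close> is constant in
    \<open>r\<close>. Since the derivative of \<open>u\<close> really exists, this determines the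
    value of \<open>right_deriv\<close> on the product.\<close>
  then have "((\<lambda>r. u r * \<psi> l \<theta>) has_real_derivative right_deriv u R\<^sub>j * \<psi> l \<theta>) (at_right R\<^sub>j)" for \<theta>
    by (rule DERIV_cmult_right)
  then have "right_deriv (\<lambda>r. u r * \<psi> l \<theta>) R\<^sub>j = right_deriv u R\<^sub>j * \<psi> l \<theta>" for \<theta>
    unfolding right_deriv_def[of "\<lambda>r. u r * \<psi> l \<theta>"] has_real_derivative_iff_has_vector_derivative
    by (intro vector_derivative_within) simp_all
  then show ?thesis
    unfolding DtN_def w by (simp add: Let_def mult.assoc)
qed

end
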